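(* Let $p,q\ge 2$ be integers and let $G$ be a finite simple semiregular graph with edge set $E$ and edge degree $p+q$, i.e. $G$ is a finite simple connected bipartite graph in which every edge connects a vertex of degree $p+1$ to a vertex of degree $q+1$. There is a constant $C_G>0$ depending only on $G$ such that for every function $f:E\to\mathbb{R}$ there is a number $\beta_{\max}\in\{(pq)^{-1/2}\}\cup[(pq)^{-1/4},1)$ such that both of the following hold with these same constants: (i) for every directed edge $a$ in $G$ and every integer $r\ge 0$, $\big|M_{r,a}(f)-\frac{1}{|E|}\sum_{e\in E}f(e)\big|\le C_G\|f\|_2\beta_{\max}^{\,r}$; (ii) for every vertex $v_0$ of the universal covering tree $\widetilde G$ and every integer $r\ge 0$, $$\Big|\frac{1}{|S'_r(v_0)|}\sum_{e\in S'_r(v_0)}\tilde f(e)-\frac{1}{|E|}\sum_{e\in E}f(e)\Big|\le C_G\,\|f\|_2\,\beta_{\max}^{\,r}.$$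
   Context: Simple means no loops and no multiple edges. The edge degree of $e$ is the number of edges meeting $e$ in either of its endpoints. The norm is $\|f\|_2=\langle f,f\rangle^{1/2}$ with $\langle f,g\rangle=\sum_{e\in E}f(e)g(e)$. Universal cover: $\widetilde G$ is the universal covering tree of $G$, with vertex set $\widetilde V$ and edge set $\widetilde E$: fix a root vertex of $G$; the vertices of $\widetilde G$ are the non-backtracking paths in $G$ starting at the root, two being adjacent if they differ by exactly one edge at the end. The projection $\pi:\widetilde G\to G$ sends a path to its end vertex, and $\pi(\{\tilde v,\tilde w\})=\{\pi(\tilde v),\pi(\tilde w)\}$ on edges. The lift of $f$ is $\tilde f=f\circ\pi$. $\delta$ is the combinatorial distance between vertices. Edge spheres and arcs: for $v_0\in\widetilde V$, $S'_r(v_0)=\{e=\{x,y\}\in\widetilde E:\min\{\delta(x,v_0),\delta(y,v_0)\}=r\}$. For a directed edge $a$ of $\widetilde G$ from $w'$ to $w$, $A'_0(a)=\{a\}$ and $A'_{r+1}(a)=S'_{r+1}(w')\cap S'_r(w)$ for $r\ge0$, and $M_{r,a}(f)=\frac{1}{|A'_r(a)|}\sum_{x\in A'_r(a)}\tilde f(x)$. For a directed edge $a$ of $G$, $M_{r,a}(f)$ is computed using any lift of $a$ to $\widetilde G$ (the value does not depend on the lift). The constant $C_G$ does not depend on $a$, $v_0$, $f$, $r$; the rate $\beta_{\max}$ may depend on $G$ and $f$ but not on $a$, $v_0$ or $r$. *)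

theory Defs
  imports Complex_Main "HOL-Analysis.L2_Norm"
begin

text \<open>A graph is given by a vertex set \<open>V\<close> and a set \<open>E\<close> of two-element subsets of \<open>V\<close>; this
  encoding excludes loops and multiple edges.\<close>

definition simple_graph :: "'a set \<Rightarrow> 'a set set \<Rightarrow> bool" where
  "simple_graph V E \<longleftrightarrow> (\<forall>e\<in>E. \<exists>u\<in>V. \<exists>v\<in>V. u \<noteq> v \<and> e = {u, v})"

definition walk :: "'a set \<Rightarrow> 'a set set \<Rightarrow> 'a list \<Rightarrow> bool" where
  "walk V E xs \<longleftrightarrow> xs \<noteq> [] \<and> set xs \<subseteq> V \<and> successively (\<lambda>u v. {u, v} \<in> E) xs"

definition connected_graph :: "'a set \<Rightarrow> 'a set set \<Rightarrow> bool" where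
  "connected_graph V E \<longleftrightarrow>
     V \<noteq> {} \<and> (\<forall>u\<in>V. \<forall>v\<in>V. \<exists>xs. walk V E xs \<and> hd xs = u \<and> last xs = v)"

definition graph_dist :: "'a set \<Rightarrow> 'a set set \<Rightarrow> 'a \<Rightarrow> 'a \<Rightarrow> nat" where
  "graph_dist V E u v =
     (LEAST n. \<exists>xs. walk V E xs \<and> hd xs = u \<and> last xs = v \<and> length xs = Suc n)"

definition vertex_degree :: "'a set set \<Rightarrow> 'a \<Rightarrow> nat" where
  "vertex_degree E v = card {e \<in> E. v \<in> e}"

definition bipartite_graph :: "'a set \<Rightarrow> 'a set set \<Rightarrow> bool" where
  "bipartite_graph V E \<longleftrightarrow>
     (\<exists>A B. A \<union> B = V \<and> A \<inter> B = {} \<and> (\<forall>e\<in>E. \<exists>a\<in>A. \<exists>b\<in>B. e = {a, b}))"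

definition semiregular_graph :: "'a set \<Rightarrow> 'a set set \<Rightarrow> nat \<Rightarrow> nat \<Rightarrow> bool" where
  "semiregular_graph V E p q \<longleftrightarrow>
     finite V \<and> simple_graph V E \<and> connected_graph V E \<and> bipartite_graph V E \<and>
     (\<forall>e\<in>E. \<exists>u v. e = {u, v} \<and> vertex_degree E u = p + 1 \<and> vertex_degree E v = q + 1)"

text \<open>The universal covering tree of the graph with root \<open>s\<close>. Since the graph is simple, a path is
  determined by its list of vertices, and it is non-backtracking iff no vertex recurs after
  exactly two steps. The covering projection is \<open>last\<close> on vertices and \<open>image last\<close> on edges.\<close>

definition cover_verts :: "'a set \<Rightarrow> 'a set set \<Rightarrow> 'a \<Rightarrow> 'a list set" where
  "cover_verts V E s =
     {xs. walk V E xs \<and> hd xs = s \<and> (\<forall>i. i + 2 < length xs \<longrightarrow> xs ! i \<noteq> xs ! (i + 2))}"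

definition cover_edges :: "'a set \<Rightarrow> 'a set set \<Rightarrow> 'a \<Rightarrow> 'a list set set" where
  "cover_edges V E s =
     {{xs, xs @ [v]} | xs v. xs \<in> cover_verts V E s \<and> xs @ [v] \<in> cover_verts V E s}"

definition lift_fun :: "('a set \<Rightarrow> real) \<Rightarrow> 'a list set \<Rightarrow> real" where
  "lift_fun f e = f (last ` e)"

definition edge_sphere :: "'a set \<Rightarrow> 'a set set \<Rightarrow> 'a \<Rightarrow> nat \<Rightarrow> 'a set set" where
  "edge_sphere V E v r =
     {e \<in> E. \<exists>x y. e = {x, y} \<and> min (graph_dist V E x v) (graph_dist V E y v) = r}"

text \<open>Edge arcs of the directed edge from \<open>w'\<close> to \<open>w\<close>.\<close>

primrec edge_arc :: "'a set \<Rightarrow> 'a set set \<Rightarrow> 'a \<Rightarrow> 'a \<Rightarrow> nat \<Rightarrow> 'a set set" where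
  "edge_arc V E w' w 0 = {{w', w}}"
| "edge_arc V E w' w (Suc r) = edge_sphere V E w' (Suc r) \<inter> edge_sphere V E w r"

definition average :: "('b \<Rightarrow> real) \<Rightarrow> 'b set \<Rightarrow> real" where
  "average g A = (\<Sum>x\<in>A. g x) / real (card A)"

definition arc_mean ::
    "'a set \<Rightarrow> 'a set set \<Rightarrow> 'a \<Rightarrow> ('a set \<Rightarrow> real) \<Rightarrow> 'a list \<Rightarrow> 'a list \<Rightarrow> nat \<Rightarrow> real" where
  "arc_mean V E s f w' w r =
     average (lift_fun f) (edge_arc (cover_verts V E s) (cover_edges V E s) w' w r)"

definition sphere_mean ::
    "'a set \<Rightarrow> 'a set set \<Rightarrow> 'a \<Rightarrow> ('a set \<Rightarrow> real) \<Rightarrow> 'a list \<Rightarrow> nat \<Rightarrow> real" where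
  "sphere_mean V E s f v\<^sub>0 r =
     average (lift_fun f) (edge_sphere (cover_verts V E s) (cover_edges V E s) v\<^sub>0 r)"

definition is_lift :: "'a set \<Rightarrow> 'a set set \<Rightarrow> 'a \<Rightarrow> 'a \<Rightarrow> 'a \<Rightarrow> 'a list \<Rightarrow> 'a list \<Rightarrow> bool" where
  "is_lift V E s u v w' w \<longleftrightarrow> {w', w} \<in> cover_edges V E s \<and> last w' = u \<and> last w = v"

text \<open>Every directed edge of a connected graph has a lift, so quantifying over all lifts of a
  directed edge is never vacuous.\<close>

lemma cover_step:
  assumes xs: "xs \<in> cover_verts V E s" and e: "{last xs, v} \<in> E" and v: "v \<in> V"
  shows "\<exists>ys \<in> cover_verts V E s. last ys = v \<and> {xs, ys} \<in> cover_edges V E s"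
proof (cases "length xs \<ge> 2 \<and> xs ! (length xs - 2) = v")
  case True
  then obtain ys a where xs_eq: "xs = ys @ [a]" and ys: "ys \<noteq> []"
    by (cases xs rule: rev_cases) (auto simp: Suc_le_eq)
  have "last ys = v"
    using True ys by (auto simp: xs_eq nth_append last_conv_nth)
  moreover have ys_in: "ys \<in> cover_verts V E s"
  proof -
    have "walk V E ys" "hd ys = s"
      using xs ys by (auto simp: cover_verts_def walk_def xs_eq successively_append_iff)
    moreover have "ys ! i \<noteq> ys ! (i + 2)" if i: "i + 2 < length ys" for i
    proof -
      have "xs ! i \<noteq> xs ! (i + 2)"
        using xs i by (simp add: cover_verts_def xs_eq)
      with i show ?thesis by (simp add: xs_eq nth_append)
    qed
    ultimately show ?thesis by (simp add: cover_verts_def)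
  qed
  moreover have "{xs, ys} \<in> cover_edges V E s"
  proof -
    have "{xs, ys} = {ys, ys @ [a]}" by (simp add: xs_eq insert_commute)
    with xs ys_in show ?thesis unfolding cover_edges_def xs_eq by blast
  qed
  ultimately show ?thesis by blast
next
  case False
  have "i + 2 < length (xs @ [v]) \<Longrightarrow> (xs @ [v]) ! i \<noteq> (xs @ [v]) ! (i + 2)" for i
  proof (cases "i + 2 = length xs")
    case True
    then have "i = length xs - 2" "2 \<le> length xs" by auto
    with False True show ?thesis by (auto simp: nth_append)
  next
    case neq: False
    assume "i + 2 < length (xs @ [v])"
    with neq have "i + 2 < length xs" by simp
    with xs show ?thesis by (auto simp: nth_append cover_verts_def)
  qed
  with xs e v have "xs @ [v] \<in> cover_verts V E s"
    by (auto simp: cover_verts_def walk_def successively_append_iff)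
  with xs have "{xs, xs @ [v]} \<in> cover_edges V E s"
    unfolding cover_edges_def by blast
  with \<open>xs @ [v] \<in> _\<close> show ?thesis by (intro bexI[of _ "xs @ [v]"]) simp_all
qed

lemma cover_reaches:
  assumes "walk V E xs" "hd xs = s"
  shows "\<exists>ys \<in> cover_verts V E s. last ys = last xs"
  using assms
proof (induction xs rule: rev_induct)
  case Nil
  then show ?case by (simp add: walk_def)
next
  case (snoc v xs)
  show ?case
  proof (cases "xs = []")
    case True
    with snoc.prems show ?thesis
      by (intro bexI[of _ "[v]"]) (auto simp: cover_verts_def walk_def)
  next
    case False
    with snoc.prems have "walk V E xs" "hd xs = s" "{last xs, v} \<in> E" "v \<in> V"
      by (auto simp: walk_def successively_append_iff)
    with snoc.IH obtain ys where "ys \<in> cover_verts V E s" "last ys = last xs" by blast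
    with cover_step[of ys V E s v] \<open>{last xs, v} \<in> E\<close> \<open>v \<in> V\<close> show ?thesis by auto
  qed
qed

lemma lift_exists:
  assumes "simple_graph V E" "connected_graph V E" "s \<in> V" "{u, v} \<in> E"
  shows "\<exists>w' w. is_lift V E s u v w' w"
proof -
  have uv: "u \<in> V" "v \<in> V"
  proof -
    obtain a b where "a \<in> V" "b \<in> V" "{u, v} = {a, b}"
      using assms(1,4) unfolding simple_graph_def by meson
    then show "u \<in> V" "v \<in> V" by (auto simp: doubleton_eq_iff)
  qed
  with assms obtain xs where "walk V E xs" "hd xs = s" "last xs = u"
    by (auto simp: connected_graph_def)
  with cover_reaches obtain w' where w': "w' \<in> cover_verts V E s" "last w' = u" by metis
  with cover_step[of w' V E s v] assms(4) uv obtain w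
    where "last w = v" "{w', w} \<in> cover_edges V E s" by auto
  with w' show ?thesis by (auto simp: is_lift_def)
qed

end

theory Submission
  imports Defs "HOL-Library.Sublist"
begin

text \<open>
  The rate \<open>\<beta>\<close> may be any number close enough to \<open>1\<close>, so it suffices to find one rate below \<open>1\<close> that
  depends only on the graph; then it serves every \<open>f\<close> at once.

  Let \<open>A, B\<close> be the two sides of the bipartition, and let \<open>P\<^sub>A\<close> replace the value of a function at
  an edge \<open>e\<close> by its average over the other edges at the endpoint of \<open>e\<close> in \<open>A\<close>; likewise \<open>P\<^sub>B\<close>.
  In the cover, the arc of radius \<open>r + 1\<close> of a directed edge is the disjoint union of the arcs of
  radius \<open>r\<close> of its non-backtracking continuations, and by semiregularity these have equal
  size. Hence the arc mean of radius \<open>r\<close> is the alternating product \<open>P\<^sub>B P\<^sub>A P\<^sub>B \<dots>\<close> of length \<open>r\<close> (or the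
  one starting with \<open>P\<^sub>A\<close>), applied to \<open>f\<close> and evaluated at the projected edge
  (\<open>edge_arc_zigzag\<close>). A sphere is a disjoint union of arcs of equal size, so its mean is an average
  of arc means (\<open>sphere_mean_eq_average_arc_means\<close>).

  Each of \<open>P\<^sub>A, P\<^sub>B\<close> preserves the total and is an \<open>L\<^sup>2\<close> contraction: on the star of a vertex of degree
  \<open>k + 1\<close> it fixes the constants and multiplies their orthogonal complement by \<open>-1/k\<close>, where \<open>k \<ge> 2\<close>.
  So \<open>P\<^sub>A P\<^sub>B\<close> can nearly preserve the norm of \<open>f\<close> only if \<open>f\<close> is nearly constant on all stars, and
  then, the graph being connected, nearly constant; for \<open>f\<close> of mean zero this forces \<open>f\<close> to be small.
  Therefore \<open>P\<^sub>A P\<^sub>B\<close> contracts the functions of mean zero by a fixed factor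
  (\<open>two_turns_contract\<close>), and the alternating products converge to the mean geometrically
  (\<open>zigzag_mixing\<close>).
\<close>

section \<open>Averages\<close>

lemma average_diff_const:
  assumes "finite A" "A \<noteq> {}"
  shows "average (\<lambda>x. g x - c) A = average g A - c"
  using assms by (simp add: average_def sum_subtractf field_simps)

lemma average_cong: "(\<And>x. x \<in> A \<Longrightarrow> g x = h x) \<Longrightarrow> average g A = average h A"
  by (simp add: average_def)

lemma average_image: "inj_on h A \<Longrightarrow> average g (h ` A) = average (\<lambda>x. g (h x)) A"
  by (simp add: average_def sum.reindex card_image)

lemma average_UN_equal_card:
  assumes "finite I" "\<And>i. i \<in> I \<Longrightarrow> finite (B i)" "\<And>i. i \<in> I \<Longrightarrow> card (B i) = n"
    and "\<And>i j. i \<in> I \<Longrightarrow> j \<in> I \<Longrightarrow> i \<noteq> j \<Longrightarrow> B i \<inter> B j = {}"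
  shows "average g (\<Union>i\<in>I. B i) = average (\<lambda>i. average g (B i)) I"
proof -
  have "sum g (\<Union>i\<in>I. B i) = (\<Sum>i\<in>I. sum g (B i))"
    using assms by (intro sum.UNION_disjoint) auto
  moreover have "card (\<Union>i\<in>I. B i) = card I * n"
    using assms by (subst card_UN_disjoint) auto
  ultimately show ?thesis
    using assms(3) by (simp add: average_def sum_divide_distrib[symmetric])
qed

lemma abs_average_diff_le:
  assumes "finite A" "A \<noteq> {}" "\<And>x. x \<in> A \<Longrightarrow> \<bar>g x - c\<bar> \<le> b"
  shows "\<bar>average g A - c\<bar> \<le> b"
proof -
  have "average g A - c = average (\<lambda>x. g x - c) A"
    using average_diff_const[OF assms(1,2)] by simp
  also have "\<bar>\<dots>\<bar> \<le> (\<Sum>x\<in>A. \<bar>g x - c\<bar>) / card A"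
    by (simp add: average_def divide_right_mono)
  also have "\<dots> \<le> (card A * b) / card A"
    using sum_bounded_above[of A "\<lambda>x. \<bar>g x - c\<bar>" b] assms(3) by (intro divide_right_mono) auto
  also have "\<dots> = b" using assms(1,2) by simp
  finally show ?thesis .
qed

text \<open>Writing \<open>f = m + h\<close> on \<open>C\<close>, with \<open>m\<close> the mean and \<open>h\<close> of sum zero, the values of \<open>h\<close> off \<open>e\<close> sum
  to \<open>- h e\<close>. So averaging over the others fixes the constants and scales \<open>h\<close> by
  \<open>- 1 / (card C - 1)\<close>.\<close>

lemma average_others:
  assumes "finite C" "3 \<le> card C" "e \<in> C"
  shows "average f (C - {e}) = average f C - (f e - average f C) / (real (card C) - 1)"
proof -
  define d where "d = real (card C) - 1"
  have d: "d \<ge> 2" using assms(2) by (simp add: d_def)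
  have "sum f (C - {e}) = (d + 1) * average f C - f e"
    using assms by (simp add: average_def sum_diff1 d_def)
  moreover have "real (card (C - {e})) = d"
    using assms by (simp add: of_nat_diff d_def)
  ultimately have "average f (C - {e}) = ((d + 1) * average f C - f e) / d"
    by (simp only: average_def[of f "C - {e}"])
  also have "\<dots> = average f C - (f e - average f C) / d"
    using d by (simp add: field_simps)
  finally show ?thesis by (simp add: d_def)
qed

lemma sum_deviations: "finite C \<Longrightarrow> (\<Sum>e\<in>C. f e - average f C) = 0"
  by (cases "C = {}") (simp_all add: sum_subtractf average_def)

lemma sum_average_others:
  assumes "finite C" "3 \<le> card C"
  shows "(\<Sum>e\<in>C. average f (C - {e})) = sum f C"
proof -
  have "(\<Sum>e\<in>C. average f (C - {e})) = 
      (\<Sum>e\<in>C. average f C - (f e - average f C) / (real (card C) - 1))"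
    using assms by (intro sum.cong) (auto simp: average_others)
  also have "\<dots> = (\<Sum>e\<in>C. average f C)"
    using sum_deviations[OF assms(1), of f]
    by (simp add: sum_subtractf[of "\<lambda>_. average f C"] sum_divide_distrib[symmetric])
  also have "\<dots> = sum f C" using assms by (simp add: average_def)
  finally show ?thesis .
qed

text \<open>With three or more elements the scaling factor has modulus at most \<open>1/2\<close>, so at least
  three quarters of the energy of the mean-zero component is lost.\<close>

lemma sum_squares_average_others:
  assumes "finite C" "3 \<le> card C"
  shows "(\<Sum>e\<in>C. (average f (C - {e}))\<^sup>2) + 3/4 * (\<Sum>e\<in>C. (f e - average f C)\<^sup>2) \<le> (\<Sum>e\<in>C. (f e)\<^sup>2)"
proof -
  define m d where "m = average f C" and "d = real (card C) - 1"
  have d: "d \<ge> 2" using assms(2) by (simp add: d_def)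
  have zero: "(\<Sum>e\<in>C. k * (f e - m)) = 0" for k
    using sum_deviations[OF assms(1), of f] by (simp add: sum_distrib_left[symmetric] m_def)
  have "1 / d \<le> 1 / 2" using d by (intro divide_left_mono) auto
  then have d2: "1 / d\<^sup>2 \<le> 1 / 4"
    using power_mono[of "1/d" "1/2" 2] d by (simp add: power_divide)
  have "(\<Sum>e\<in>C. (average f (C - {e}))\<^sup>2) + 3/4 * (\<Sum>e\<in>C. (f e - m)\<^sup>2)
      = (\<Sum>e\<in>C. (m - (f e - m) / d)\<^sup>2 + 3/4 * (f e - m)\<^sup>2)"
    unfolding sum.distrib sum_distrib_left using assms
    by (auto intro!: sum.cong simp: average_others m_def d_def)
  also have "\<dots> \<le> (\<Sum>e\<in>C. m\<^sup>2 - 2 * m / d * (f e - m) + (f e - m)\<^sup>2)"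
  proof (rule sum_mono)
    fix e
    have "(m - (f e - m) / d)\<^sup>2 = m\<^sup>2 - 2 * m / d * (f e - m) + (1 / d\<^sup>2) * (f e - m)\<^sup>2"
      using d by (simp add: power2_diff power_divide)
    moreover have "(1 / d\<^sup>2) * (f e - m)\<^sup>2 \<le> 1/4 * (f e - m)\<^sup>2"
      by (rule mult_right_mono[OF d2]) simp
    ultimately show "(m - (f e - m) / d)\<^sup>2 + 3/4 * (f e - m)\<^sup>2
        \<le> m\<^sup>2 - 2 * m / d * (f e - m) + (f e - m)\<^sup>2" by linarith
  qed
  also have "\<dots> = (\<Sum>e\<in>C. m\<^sup>2 + 2 * m * (f e - m) + (f e - m)\<^sup>2)"
    using zero[of "2 * m / d"] zero[of "2 * m"] by (simp add: sum.distrib sum_subtractf[of "\<lambda>_. m\<^sup>2"])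
  also have "\<dots> = (\<Sum>e\<in>C. (f e)\<^sup>2)"
    by (intro sum.cong) (auto simp: power2_eq_square algebra_simps)
  finally show ?thesis by (simp add: m_def)
qed

lemma average_others_near:
  assumes "finite C" "3 \<le> card C" "e \<in> C"
  shows "\<bar>average f (C - {e}) - f e\<bar> \<le> 3/2 * \<bar>f e - average f C\<bar>"
proof -
  define d where "d = real (card C) - 1"
  have d: "d \<ge> 2" using assms(2) by (simp add: d_def)
  have "average f (C - {e}) - f e = - (f e - average f C) * (1 + 1 / d)"
    using average_others[OF assms, of f] d by (simp add: d_def field_simps)
  then have "\<bar>average f (C - {e}) - f e\<bar> = \<bar>f e - average f C\<bar> * (1 + 1 / d)"
    using d by (simp only: abs_mult abs_minus_cancel) simp
  also have "1 / d \<le> 1 / 2" using d by (intro divide_left_mono) auto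
  then have "\<bar>f e - average f C\<bar> * (1 + 1 / d) \<le> \<bar>f e - average f C\<bar> * (3/2)"
    by (intro mult_left_mono) auto
  finally show ?thesis by simp
qed

section \<open>Averaging over the rest of a part\<close>

text \<open>A partition of \<open>E\<close> is given by a labelling \<open>\<alpha>\<close>; its parts are the fibres. For a bipartite graph
  the two labellings in question send an edge to the singleton of its
  endpoint on one side.\<close>

definition part_of :: "'e set \<Rightarrow> ('e \<Rightarrow> 'b) \<Rightarrow> 'e \<Rightarrow> 'e set" where
  "part_of E \<alpha> e = {e' \<in> E. \<alpha> e' = \<alpha> e}"

definition turn :: "'e set \<Rightarrow> ('e \<Rightarrow> 'b) \<Rightarrow> ('e \<Rightarrow> real) \<Rightarrow> 'e \<Rightarrow> real" where
  "turn E \<alpha> f e = average f (part_of E \<alpha> e - {e})"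

definition deviation :: "'e set \<Rightarrow> ('e \<Rightarrow> 'b) \<Rightarrow> ('e \<Rightarrow> real) \<Rightarrow> real" where
  "deviation E \<alpha> f = (\<Sum>e\<in>E. (f e - average f (part_of E \<alpha> e))\<^sup>2)"

definition thick_parts :: "'e set \<Rightarrow> ('e \<Rightarrow> 'b) \<Rightarrow> bool" where
  "thick_parts E \<alpha> \<longleftrightarrow> finite E \<and> (\<forall>e\<in>E. 3 \<le> card (part_of E \<alpha> e))"

lemma sum_by_parts:
  assumes "finite E"
  shows "(\<Sum>e\<in>E. h e) = (\<Sum>C\<in>part_of E \<alpha> ` E. \<Sum>e\<in>C. h e)"
proof -
  have "(\<Union>C\<in>part_of E \<alpha> ` E. C) = E" by (auto simp: part_of_def)
  moreover have "sum h (\<Union>C\<in>part_of E \<alpha> ` E. C) = (\<Sum>C\<in>part_of E \<alpha> ` E. sum h C)"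
    using assms by (intro sum.UNION_disjoint) (auto simp: part_of_def)
  ultimately show ?thesis by simp
qed

lemma part_of_eq: "e' \<in> part_of E \<alpha> e \<Longrightarrow> part_of E \<alpha> e' = part_of E \<alpha> e"
  by (auto simp: part_of_def)

lemma thick_partD:
  assumes "thick_parts E \<alpha>" "C \<in> part_of E \<alpha> ` E"
  shows "finite C" "3 \<le> card C"
  using assms by (auto simp: thick_parts_def part_of_def)

lemma sum_turn:
  assumes "thick_parts E \<alpha>"
  shows "sum (turn E \<alpha> f) E = sum f E"
proof -
  have fin: "finite E" using assms by (simp add: thick_parts_def)
  have "(\<Sum>e\<in>C. turn E \<alpha> f e) = sum f C" if C: "C \<in> part_of E \<alpha> ` E" for C
  proof -
    have "(\<Sum>e\<in>C. turn E \<alpha> f e) = (\<Sum>e\<in>C. average f (C - {e}))"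
      using C by (auto intro!: sum.cong simp: turn_def part_of_eq)
    then show ?thesis using sum_average_others thick_partD[OF assms C] by simp
  qed
  then show ?thesis
    by (simp add: sum_by_parts[OF fin, of "turn E \<alpha> f" \<alpha>] sum_by_parts[OF fin, of f \<alpha>])
qed

lemma sum_squares_turn:
  assumes "thick_parts E \<alpha>"
  shows "(\<Sum>e\<in>E. (turn E \<alpha> f e)\<^sup>2) + 3/4 * deviation E \<alpha> f \<le> (\<Sum>e\<in>E. (f e)\<^sup>2)"
proof -
  have fin: "finite E" using assms by (simp add: thick_parts_def)
  have "(\<Sum>e\<in>C. (turn E \<alpha> f e)\<^sup>2 + 3/4 * (f e - average f (part_of E \<alpha> e))\<^sup>2)
      \<le> (\<Sum>e\<in>C. (f e)\<^sup>2)" if C: "C \<in> part_of E \<alpha> ` E" for C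
  proof -
    have "(\<Sum>e\<in>C. (turn E \<alpha> f e)\<^sup>2 + 3/4 * (f e - average f (part_of E \<alpha> e))\<^sup>2)
        = (\<Sum>e\<in>C. (average f (C - {e}))\<^sup>2 + 3/4 * (f e - average f C)\<^sup>2)"
      using C by (auto intro!: sum.cong simp: turn_def part_of_eq)
    then show ?thesis using sum_squares_average_others thick_partD[OF assms C]
      by (simp only: sum.distrib sum_distrib_left)
  qed
  then have "(\<Sum>e\<in>E. (turn E \<alpha> f e)\<^sup>2 + 3/4 * (f e - average f (part_of E \<alpha> e))\<^sup>2)
      \<le> (\<Sum>e\<in>E. (f e)\<^sup>2)"
    unfolding sum_by_parts[OF fin, of _ \<alpha>] by (rule sum_mono)
  then show ?thesis by (simp add: deviation_def sum.distrib sum_distrib_left)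
qed

lemma abs_le_of_deviation:
  assumes "finite E" "deviation E \<alpha> f \<le> t\<^sup>2" "0 \<le> t" "e \<in> E"
  shows "\<bar>f e - average f (part_of E \<alpha> e)\<bar> \<le> t"
proof -
  have "(f e - average f (part_of E \<alpha> e))\<^sup>2 \<le> deviation E \<alpha> f"
    unfolding deviation_def using assms(1,4) by (intro member_le_sum) auto
  also note assms(2)
  finally have "\<bar>f e - average f (part_of E \<alpha> e)\<bar> \<le> \<bar>t\<bar>" by (simp only: abs_le_square_iff)
  with assms(3) show ?thesis by simp
qed

lemma abs_diff_same_part:
  assumes "finite E" "deviation E \<alpha> f \<le> t\<^sup>2" "0 \<le> t" "e \<in> E" "e' \<in> E" "\<alpha> e = \<alpha> e'"
  shows "\<bar>f e - f e'\<bar> \<le> 2 * t"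
  using abs_le_of_deviation[OF assms(1-4)] abs_le_of_deviation[OF assms(1-3) assms(5)] assms(6)
  by (simp add: part_of_def)

section \<open>Alternating between two partitions\<close>

definition same_part_rel :: "'e set \<Rightarrow> ('e \<Rightarrow> 'b) \<Rightarrow> ('e \<Rightarrow> 'b) \<Rightarrow> 'e rel" where
  "same_part_rel E \<alpha> \<beta> = {(e, e') \<in> E \<times> E. \<alpha> e = \<alpha> e' \<or> \<beta> e = \<beta> e'}"

lemma abs_diff_relpow_le:
  fixes f :: "'e \<Rightarrow> real"
  assumes "\<And>x y. (x, y) \<in> R \<Longrightarrow> \<bar>f x - f y\<bar> \<le> b" "(x, y) \<in> R ^^ n"
  shows "\<bar>f x - f y\<bar> \<le> real n * b"
  using assms(2)
proof (induction n arbitrary: y)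
  case (Suc n)
  then obtain z where "(x, z) \<in> R ^^ n" "(z, y) \<in> R"
    by (blast elim: relpow_Suc_E)
  with Suc.IH[of z] assms(1)[of z y] have "\<bar>f x - f y\<bar> \<le> real n * b + b" by linarith
  then show ?case by (simp add: algebra_simps)
qed simp

text \<open>The two estimates of \<open>sum_squares_turn\<close> bound the deviation of \<open>f\<close> on the \<open>\<beta>\<close>-parts and of
  \<open>turn E \<beta> f\<close> on the \<open>\<alpha>\<close>-parts by the lost energy. As \<open>turn E \<beta> f\<close> is then close to \<open>f\<close>, the values of
  \<open>f\<close> vary little along every step of the relation, hence along every chain, hence on all
  of \<open>E\<close>. For \<open>f\<close> of mean zero this bounds the energy of \<open>f\<close> by a multiple of the loss.\<close>

lemma two_turns_contract:
  assumes \<alpha>: "thick_parts E \<alpha>" and \<beta>: "thick_parts E \<beta>"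
    and conn: "E \<times> E \<subseteq> (same_part_rel E \<alpha> \<beta>)\<^sup>*"
  shows "\<exists>\<kappa>\<in>{0..<1}. \<forall>f :: _ \<Rightarrow> real. sum f E = 0 \<longrightarrow>
    (\<Sum>e\<in>E. (turn E \<alpha> (turn E \<beta> f) e)\<^sup>2) \<le> \<kappa> * (\<Sum>e\<in>E. (f e)\<^sup>2)"
proof -
  let ?R = "same_part_rel E \<alpha> \<beta>"
  have fin: "finite E" using \<alpha> by (simp add: thick_parts_def)
  have finR: "finite ?R"
    by (rule finite_subset[of _ "E \<times> E"]) (auto simp: same_part_rel_def fin)
  define N where "N = card ?R"
  \<comment> \<open>A step changes \<open>f\<close> by at most \<open>5 * sqrt (2 * loss)\<close> and a chain has at most \<open>N\<close> steps, so
    \<open>(f x)\<^sup>2 \<le> 50 * N\<^sup>2 * loss\<close>; the summand \<open>1\<close> keeps \<open>K\<close> positive.\<close>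
  define K where "K = 1 + 50 * real (card E) * (real N)\<^sup>2"
  have K: "K \<ge> 1" by (simp add: K_def)
  have "(\<Sum>e\<in>E. (turn E \<alpha> (turn E \<beta> f) e)\<^sup>2) \<le> (1 - 1 / K) * (\<Sum>e\<in>E. (f e)\<^sup>2)"
    if mean: "sum f E = 0" for f
  proof -
    define g where "g = turn E \<beta> f"
    define loss where "loss = (\<Sum>e\<in>E. (f e)\<^sup>2) - (\<Sum>e\<in>E. (turn E \<alpha> g e)\<^sup>2)"
    have "(\<Sum>e\<in>E. (g e)\<^sup>2) + 3/4 * deviation E \<beta> f \<le> (\<Sum>e\<in>E. (f e)\<^sup>2)"
      "(\<Sum>e\<in>E. (turn E \<alpha> g e)\<^sup>2) + 3/4 * deviation E \<alpha> g \<le> (\<Sum>e\<in>E. (g e)\<^sup>2)"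
      unfolding g_def by (intro sum_squares_turn \<alpha> \<beta>)+
    moreover have "deviation E \<beta> f \<ge> 0" "deviation E \<alpha> g \<ge> 0"
      by (auto simp: deviation_def intro: sum_nonneg)
    ultimately have loss: "loss \<ge> 0" "deviation E \<beta> f \<le> 2 * loss" "deviation E \<alpha> g \<le> 2 * loss"
      unfolding loss_def by argo+
    define t where "t = sqrt (2 * loss)"
    have t: "t \<ge> 0" "t\<^sup>2 = 2 * loss" using loss by (simp_all add: t_def)
    have dev: "deviation E \<beta> f \<le> t\<^sup>2" "deviation E \<alpha> g \<le> t\<^sup>2" using loss t by auto
    have near: "\<bar>g e - f e\<bar> \<le> 3/2 * t" if "e \<in> E" for e
    proof -
      have "\<bar>g e - f e\<bar> \<le> 3/2 * \<bar>f e - average f (part_of E \<beta> e)\<bar>"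
        unfolding g_def turn_def using that \<beta>
        by (intro average_others_near) (auto simp: thick_parts_def part_of_def)
      also have "\<dots> \<le> 3/2 * t"
        using abs_le_of_deviation[OF fin dev(1) t(1) that] by (intro mult_left_mono) auto
      finally show ?thesis .
    qed
    have step: "\<bar>f x - f y\<bar> \<le> 5 * t" if "(x, y) \<in> ?R" for x y
    proof -
      from that have xy: "x \<in> E" "y \<in> E" and "\<alpha> x = \<alpha> y \<or> \<beta> x = \<beta> y"
        by (auto simp: same_part_rel_def)
      from this(3) show ?thesis
      proof
        assume "\<alpha> x = \<alpha> y"
        from abs_diff_same_part[OF fin dev(2) t(1) xy this] near[OF xy(1)] near[OF xy(2)]
        show ?thesis by linarith
      next
        assume "\<beta> x = \<beta> y"
        from abs_diff_same_part[OF fin dev(1) t(1) xy this] t(1) show ?thesis by linarith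
      qed
    qed
    have pair: "\<bar>f x - f y\<bar> \<le> real N * (5 * t)" if "x \<in> E" "y \<in> E" for x y
    proof -
      from conn that have "(x, y) \<in> ?R\<^sup>*" by auto
      then obtain n where n: "n \<le> N" "(x, y) \<in> ?R ^^ n"
        by (auto simp: rtrancl_finite_eq_relpow[OF finR] N_def)
      have "\<bar>f x - f y\<bar> \<le> real n * (5 * t)"
        using step n(2) by (rule abs_diff_relpow_le)
      also have "\<dots> \<le> real N * (5 * t)" using n(1) t(1) by (intro mult_right_mono) auto
      finally show ?thesis .
    qed
    have point: "(f x)\<^sup>2 \<le> 50 * (real N)\<^sup>2 * loss" if "x \<in> E" for x
    proof -
      have "\<bar>average f E - f x\<bar> \<le> real N * (5 * t)"
        using that pair[of _ x] fin by (intro abs_average_diff_le) auto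
      then have "\<bar>f x\<bar> \<le> real N * (5 * t)" by (simp add: average_def mean)
      then have "\<bar>f x\<bar>\<^sup>2 \<le> (real N * (5 * t))\<^sup>2" by (rule power_mono) simp
      then show ?thesis by (simp add: power_mult_distrib t(2) algebra_simps)
    qed
    have "(\<Sum>e\<in>E. (f e)\<^sup>2) \<le> card E * (50 * (real N)\<^sup>2 * loss)"
      by (rule sum_bounded_above) (rule point)
    also have "\<dots> \<le> K * loss" using loss(1) by (simp add: K_def algebra_simps)
    finally have "(\<Sum>e\<in>E. (f e)\<^sup>2) / K \<le> loss" using K by (simp add: field_simps)
    then show ?thesis by (simp add: loss_def g_def algebra_simps)
  qed
  moreover have "1 - 1 / K \<in> {0..<1}" using K by auto
  ultimately show ?thesis by blast
qed

text \<open>The order of the labellings is exchanged at each step, so the outermost turn of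
  \<open>zigzag E \<alpha> \<beta>\<close> is about \<open>\<alpha>\<close>: this is the first turn of a walk, while \<open>f\<close> is evaluated at its end.\<close>

fun zigzag :: "'e set \<Rightarrow> ('e \<Rightarrow> 'b) \<Rightarrow> ('e \<Rightarrow> 'b) \<Rightarrow> nat \<Rightarrow> ('e \<Rightarrow> real) \<Rightarrow> 'e \<Rightarrow> real" where
  "zigzag E \<alpha> \<beta> 0 f = f"
| "zigzag E \<alpha> \<beta> (Suc r) f = turn E \<alpha> (zigzag E \<beta> \<alpha> r f)"

lemma turn_cong:
  "(\<And>e. e \<in> E \<Longrightarrow> f e = g e) \<Longrightarrow> turn E \<alpha> f e = turn E \<alpha> g e"
  unfolding turn_def by (rule average_cong) (auto simp: part_of_def)

lemma turn_diff_const: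
  assumes "thick_parts E \<alpha>" "e \<in> E"
  shows "turn E \<alpha> (\<lambda>e. f e - c) e = turn E \<alpha> f e - c"
proof -
  have "finite (part_of E \<alpha> e)" "3 \<le> card (part_of E \<alpha> e)"
    using assms by (auto simp: thick_parts_def part_of_def)
  moreover have "part_of E \<alpha> e - {e} \<noteq> {}"
  proof -
    have "card (part_of E \<alpha> e - {e}) = card (part_of E \<alpha> e) - 1"
      using assms(2) by (simp add: part_of_def)
    then have "card (part_of E \<alpha> e - {e}) \<noteq> 0" using \<open>3 \<le> card _\<close> by simp
    then show ?thesis by (metis card.empty)
  qed
  ultimately show ?thesis unfolding turn_def by (intro average_diff_const) auto
qed

lemma zigzag_diff_const:
  assumes "thick_parts E \<alpha>" "thick_parts E \<beta>" "e \<in> E"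
  shows "zigzag E \<alpha> \<beta> r (\<lambda>e. f e - c) e = zigzag E \<alpha> \<beta> r f e - c"
  using assms
proof (induction r arbitrary: \<alpha> \<beta> e)
  case (Suc r)
  have "zigzag E \<alpha> \<beta> (Suc r) (\<lambda>e. f e - c) e = turn E \<alpha> (\<lambda>e. zigzag E \<beta> \<alpha> r f e - c) e"
    using Suc by (auto intro: turn_cong)
  then show ?case using turn_diff_const[OF Suc.prems(1,3)] by simp
qed simp

lemma sum_zigzag:
  "thick_parts E \<alpha> \<Longrightarrow> thick_parts E \<beta> \<Longrightarrow> sum (zigzag E \<alpha> \<beta> r f) E = sum f E"
  by (induction r arbitrary: \<alpha> \<beta>) (simp_all add: sum_turn)

lemma zigzag_contract:
  assumes "thick_parts E \<alpha>" "thick_parts E \<beta>" "0 \<le> \<kappa>" "sum f E = 0"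
    and "\<And>f. sum f E = 0 \<Longrightarrow>
      (\<Sum>e\<in>E. (turn E \<alpha> (turn E \<beta> f) e)\<^sup>2) \<le> \<kappa> * (\<Sum>e\<in>E. (f e)\<^sup>2)"
  shows "(\<Sum>e\<in>E. (zigzag E \<alpha> \<beta> r f e)\<^sup>2) \<le> \<kappa> ^ (r div 2) * (\<Sum>e\<in>E. (f e)\<^sup>2)"
proof (induction r rule: less_induct)
  case (less r)
  consider "r = 0" | "r = 1" | n where "r = Suc (Suc n)"
    by (metis One_nat_def not0_implies_Suc)
  then show ?case
  proof cases
    case 2
    have "0 \<le> deviation E \<alpha> f" by (simp add: deviation_def sum_nonneg)
    with sum_squares_turn[OF assms(1), of f] 2 show ?thesis by simp
  next
    case (3 n)
    have "(\<Sum>e\<in>E. (zigzag E \<alpha> \<beta> r f e)\<^sup>2) \<le> \<kappa> * (\<Sum>e\<in>E. (zigzag E \<alpha> \<beta> n f e)\<^sup>2)"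
      using assms(5)[of "zigzag E \<alpha> \<beta> n f"] sum_zigzag[OF assms(1,2), of n f] assms(4) 3 by simp
    also have "\<dots> \<le> \<kappa> * (\<kappa> ^ (n div 2) * (\<Sum>e\<in>E. (f e)\<^sup>2))"
      using less.IH[of n] 3 assms(3) by (intro mult_left_mono) auto
    finally show ?thesis using 3 by (simp add: mult.assoc)
  qed simp
qed

lemma sum_squares_deviation_le:
  assumes "finite E"
  shows "(\<Sum>e\<in>E. (f e - average f E)\<^sup>2) \<le> (\<Sum>e\<in>E. (f e)\<^sup>2)"
proof -
  let ?m = "average f E"
  have "(\<Sum>e\<in>E. (f e)\<^sup>2) = (\<Sum>e\<in>E. ?m\<^sup>2 + 2 * ?m * (f e - ?m) + (f e - ?m)\<^sup>2)"
    by (intro sum.cong) (auto simp: power2_eq_square algebra_simps)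
  also have "\<dots> = card E * ?m\<^sup>2 + (\<Sum>e\<in>E. (f e - ?m)\<^sup>2)"
    using sum_deviations[OF assms, of f] by (simp add: sum.distrib sum_distrib_left[symmetric])
  finally show ?thesis by simp
qed

text \<open>The contraction acts once in two steps, so the rate is a square root of the contraction
  factor of the norm. The factor \<open>1 / b\<close> pays for the unpaired step when \<open>r\<close> is odd.\<close>

lemma zigzag_mixing:
  assumes "thick_parts E \<alpha>" "thick_parts E \<beta>" "E \<times> E \<subseteq> (same_part_rel E \<alpha> \<beta>)\<^sup>*"
  shows "\<exists>\<rho>\<in>{0..<1}. \<forall>b f e r. \<rho> \<le> b \<longrightarrow> 0 < b \<longrightarrow> b \<le> 1 \<longrightarrow> e \<in> E \<longrightarrow>
    \<bar>zigzag E \<alpha> \<beta> r f e - average f E\<bar> \<le> 1 / b * L2_set f E * b ^ r"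
proof -
  from two_turns_contract[OF assms] obtain \<kappa> where \<kappa>: "0 \<le> \<kappa>" "\<kappa> < 1"
    and contract: "\<And>f. sum f E = 0 \<Longrightarrow>
      (\<Sum>e\<in>E. (turn E \<alpha> (turn E \<beta> f) e)\<^sup>2) \<le> \<kappa> * (\<Sum>e\<in>E. (f e)\<^sup>2)"
    by auto
  have fin: "finite E" using assms(1) by (simp add: thick_parts_def)
  \<comment> \<open>One root because \<open>\<kappa>\<close> bounds squared norms, another because it accounts for two steps.\<close>
  define \<rho> where "\<rho> = root 4 \<kappa>"
  have \<rho>: "0 \<le> \<rho>" "\<rho> < 1" "\<kappa> = \<rho> ^ 4" using \<kappa> by (auto simp: \<rho>_def)
  have "\<bar>zigzag E \<alpha> \<beta> r f e - average f E\<bar> \<le> 1 / b * L2_set f E * b ^ r"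
    if b: "\<rho> \<le> b" "0 < b" "b \<le> 1" and e: "e \<in> E" for b f e r
  proof -
    define g where "g = (\<lambda>e. f e - average f E)"
    have "\<kappa> ^ (r div 2) = (\<rho> ^ (2 * (r div 2)))\<^sup>2"
      by (simp add: \<rho>(3) flip: power_mult)
    also have "\<dots> \<le> (b ^ r / b)\<^sup>2"
    proof (rule power_mono)
      have "b ^ Suc (2 * (r div 2)) \<le> b ^ r" using b by (intro power_decreasing) auto
      then have "b ^ (2 * (r div 2)) \<le> b ^ r / b" using b by (simp add: field_simps)
      moreover have "\<rho> ^ (2 * (r div 2)) \<le> b ^ (2 * (r div 2))"
        using \<rho>(1) b(1) by (intro power_mono) auto
      ultimately show "\<rho> ^ (2 * (r div 2)) \<le> b ^ r / b" by linarith
    qed (use \<rho>(1) in simp)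
    finally have pow: "\<kappa> ^ (r div 2) \<le> (b ^ r / b)\<^sup>2" .
    have "(zigzag E \<alpha> \<beta> r f e - average f E)\<^sup>2 = (zigzag E \<alpha> \<beta> r g e)\<^sup>2"
      using zigzag_diff_const[OF assms(1,2) e] by (simp add: g_def)
    also have "\<dots> \<le> (\<Sum>e\<in>E. (zigzag E \<alpha> \<beta> r g e)\<^sup>2)" using fin e by (intro member_le_sum) auto
    also have "\<dots> \<le> \<kappa> ^ (r div 2) * (\<Sum>e\<in>E. (g e)\<^sup>2)"
      using sum_deviations[OF fin, of f]
      by (intro zigzag_contract assms(1,2) \<kappa>(1) contract) (auto simp: g_def)
    also have "\<dots> \<le> (b ^ r / b)\<^sup>2 * (\<Sum>e\<in>E. (f e)\<^sup>2)"
      unfolding g_def by (intro mult_mono pow sum_squares_deviation_le fin) (auto intro: sum_nonneg)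
    also have "\<dots> = (1 / b * L2_set f E * b ^ r)\<^sup>2"
      by (simp add: L2_set_def power_mult_distrib power_divide sum_nonneg)
    finally have "\<bar>zigzag E \<alpha> \<beta> r f e - average f E\<bar> \<le> \<bar>1 / b * L2_set f E * b ^ r\<bar>"
      unfolding abs_le_square_iff .
    then show ?thesis using b by (simp add: L2_set_nonneg abs_mult)
  qed
  moreover have "\<rho> \<in> {0..<1}" using \<rho> by simp
  ultimately show ?thesis by blast
qed

section \<open>Arcs and spheres in trees\<close>

text \<open>The Lipschitz bound shows that no walk from \<open>x\<close> to \<open>c\<close> is shorter than \<open>h x\<close>, and repeated descent
  gives a walk of exactly this length.\<close>

lemma graph_dist_eqI:
  assumes "c \<in> V" "h c = (0 :: nat)"
    and lip: "\<And>x y. {x, y} \<in> E \<Longrightarrow> h x \<le> Suc (h y)"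
    and descend: "\<And>x. x \<in> V \<Longrightarrow> x \<noteq> c \<Longrightarrow> \<exists>y\<in>V. {x, y} \<in> E \<and> h x = Suc (h y)"
    and "x \<in> V"
  shows "graph_dist V E x c = h x"
  unfolding graph_dist_def
proof (rule Least_equality)
  show "\<exists>xs. walk V E xs \<and> hd xs = x \<and> last xs = c \<and> length xs = Suc (h x)"
    using \<open>x \<in> V\<close>
  proof (induction "h x" arbitrary: x)
    case 0
    then have "x = c" using descend[of x] by force
    then show ?case using 0 assms(1,2) by (intro exI[of _ "[c]"]) (simp add: walk_def)
  next
    case (Suc n)
    then have "x \<noteq> c" using assms(2) by auto
    then obtain y where y: "y \<in> V" "{x, y} \<in> E" "h x = Suc (h y)" using descend Suc.prems by blast
    with Suc obtain xs where "walk V E xs" "hd xs = y" "last xs = c" "length xs = Suc (h y)"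
      by (metis Suc_inject)
    with y Suc.prems show ?case
      by (intro exI[of _ "x # xs"]) (auto simp: walk_def successively_Cons)
  qed
next
  fix n assume "\<exists>xs. walk V E xs \<and> hd xs = x \<and> last xs = c \<and> length xs = Suc n"
  then obtain xs where xs: "walk V E xs" "hd xs = x" "last xs = c" "length xs = Suc n" by blast
  have "h (hd xs) \<le> h (last xs) + (length xs - 1)"
    if "successively (\<lambda>u v. {u, v} \<in> E) xs" "xs \<noteq> []" for xs
    using that
  proof (induction xs)
    case (Cons a xs)
    show ?case
    proof (cases "xs = []")
      case False
      then have "h (hd xs) \<le> h (last xs) + (length xs - 1)" "{a, hd xs} \<in> E" "length xs \<ge> 1"
        using Cons by (auto simp: successively_Cons Suc_le_eq)
      with lip[of a "hd xs"] False show ?thesis by simp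
    qed simp
  qed simp
  from this[of xs] xs assms(2) show "h x \<le> n" by (simp add: walk_def)
qed

definition nbrs :: "'v set set \<Rightarrow> 'v \<Rightarrow> 'v set" where
  "nbrs E v = {x. {v, x} \<in> E}"

text \<open>The properties of the distance in a tree that determine spheres and arcs: from every vertex
  \<open>x \<noteq> c\<close> exactly one edge leads towards \<open>c\<close>, and all others lead away from it.\<close>

locale distance_tree =
  fixes V :: "'v set" and E :: "'v set set"
  assumes edge_verts: "{x, y} \<in> E \<Longrightarrow> x \<in> V \<and> y \<in> V"
    and dist_eq_0: "x \<in> V \<Longrightarrow> y \<in> V \<Longrightarrow> graph_dist V E x y = 0 \<longleftrightarrow> x = y"
    and dist_sym: "x \<in> V \<Longrightarrow> y \<in> V \<Longrightarrow> graph_dist V E x y = graph_dist V E y x"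
    and dist_step: "{x, y} \<in> E \<Longrightarrow> c \<in> V \<Longrightarrow>
      graph_dist V E x c = Suc (graph_dist V E y c) \<or> graph_dist V E y c = Suc (graph_dist V E x c)"
    and closer_exists: "x \<in> V \<Longrightarrow> c \<in> V \<Longrightarrow> x \<noteq> c \<Longrightarrow>
      \<exists>y. {x, y} \<in> E \<and> graph_dist V E y c < graph_dist V E x c"
    and closer_unique: "{x, y} \<in> E \<Longrightarrow> {x, z} \<in> E \<Longrightarrow> c \<in> V \<Longrightarrow>
      graph_dist V E y c < graph_dist V E x c \<Longrightarrow> graph_dist V E z c < graph_dist V E x c \<Longrightarrow> y = z"
begin

abbreviation d where "d \<equiv> graph_dist V E"

lemma edge_sphereE:
  assumes "e \<in> edge_sphere V E v r" "v \<in> V"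
  obtains y z where "e = {y, z}" "{y, z} \<in> E" "d y v = r" "d z v = Suc r"
proof -
  from assms(1) obtain x y where xy: "{x, y} \<in> E" "e = {x, y}" "min (d x v) (d y v) = r"
    by (auto simp: edge_sphere_def)
  from dist_step[OF xy(1) assms(2)] show ?thesis
  proof
    assume "d x v = Suc (d y v)"
    with xy show ?thesis by (intro that[of y x]) (auto simp: insert_commute)
  next
    assume "d y v = Suc (d x v)"
    with xy show ?thesis by (intro that[of x y]) auto
  qed
qed

lemma edge_sphere_radius:
  "e \<in> edge_sphere V E v r \<Longrightarrow> e \<in> edge_sphere V E v r' \<Longrightarrow> r = r'"
  by (auto simp: edge_sphere_def doubleton_eq_iff min.commute)

lemma edge_sphere_iff: "{y, z} \<in> edge_sphere V E v r \<longleftrightarrow> {y, z} \<in> E \<and> min (d y v) (d z v) = r"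
  by (auto simp: edge_sphere_def doubleton_eq_iff min.commute)

text \<open>An edge on the sphere of \<open>v\<close> belongs to the arc of \<open>v \<rightarrow> x\<close> iff \<open>x\<close> is the neighbour of \<open>v\<close> towards
  the far end \<open>z\<close> of that edge. The far end never equals \<open>v\<close>, so this covers radius \<open>0\<close> too, and
  every edge of the sphere lies in exactly one arc.\<close>

lemma edge_arc_iff:
  assumes vx: "{v, x} \<in> E" and yz: "{y, z} \<in> E" and near: "d y v = r" and far: "d z v = Suc r"
  shows "{y, z} \<in> edge_arc V E v x r \<longleftrightarrow> d x z < d v z"
proof -
  have V: "v \<in> V" "x \<in> V" "y \<in> V" "z \<in> V" using edge_verts vx yz by blast+
  have xv: "{x, v} \<in> E" using vx by (simp add: insert_commute)
  have zv: "d v z = Suc r" using dist_sym[OF V(1,4)] far by simp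
  show ?thesis
  proof (cases r)
    case 0
    then have "y = v" using near V dist_eq_0 by simp
    moreover have "d x z < d v z \<longleftrightarrow> x = z" using zv 0 dist_eq_0 V by simp
    ultimately show ?thesis using 0 by (auto simp: doubleton_eq_iff)
  next
    case (Suc k)
    have arc: "{y, z} \<in> edge_arc V E v x r \<longleftrightarrow> min (d y x) (d z x) = k"
      using Suc yz near far by (auto simp: edge_sphere_iff)
    have vy: "d v y = Suc k" using dist_sym[OF V(1,3)] near Suc by simp
    have zx: "d z x = d x z" "d y x = d x y" using dist_sym V by auto
    have stepx: "d z x = Suc (d y x) \<or> d y x = Suc (d z x)"
      using dist_step[OF yz V(2)] by auto
    have stepz: "d x z = Suc (d v z) \<or> d v z = Suc (d x z)" using dist_step[OF xv V(4)] .
    have stepy: "d x y = Suc (d v y) \<or> d v y = Suc (d x y)" using dist_step[OF xv V(3)] .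
    \<comment> \<open>The neighbour \<open>x'\<close> of \<open>v\<close> towards \<open>y\<close> also leads towards \<open>z\<close>, so it is \<open>x\<close>.\<close>
    have "d x y < d v y" if lt: "d x z < d v z"
    proof -
      from vy V dist_eq_0 have "v \<noteq> y" by force
      with closer_exists V obtain x' where x': "{v, x'} \<in> E" "d x' y < d v y" by blast
      then have x'V: "x' \<in> V" using edge_verts by blast
      have "d x' z \<le> Suc (d x' y)"
        using dist_step[OF yz x'V] dist_sym[OF x'V] V by auto
      also have "\<dots> < d v z" using x'(2) vy zv Suc by simp
      finally have "x' = x" using closer_unique[OF x'(1) vx V(4)] lt by simp
      with x' show ?thesis by simp
    qed
    then have "min (d x y) (d x z) = k \<longleftrightarrow> d x z < d v z"
      using stepx stepy stepz vy zv unfolding zx Suc by arith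
    with arc show ?thesis unfolding zx by blast
  qed
qed

lemma edge_arc_subset_sphere:
  assumes "{v, x} \<in> E"
  shows "edge_arc V E v x r \<subseteq> edge_sphere V E v r"
proof -
  have "d v v = 0" using assms edge_verts[of v x] dist_eq_0 by simp
  then have "{v, x} \<in> edge_sphere V E v 0" using assms by (simp add: edge_sphere_iff)
  then show ?thesis by (cases r) simp_all
qed

lemma edge_sphere_eq_UN_arcs:
  assumes v: "v \<in> V"
  shows "edge_sphere V E v r = (\<Union>x\<in>nbrs E v. edge_arc V E v x r)"
proof (intro equalityI subsetI)
  fix e assume "e \<in> edge_sphere V E v r"
  then obtain y z where e: "e = {y, z}" "{y, z} \<in> E" "d y v = r" "d z v = Suc r"
    using v by (rule edge_sphereE)
  then have z: "z \<in> V" using edge_verts by blast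
  with v e(4) dist_eq_0 have "v \<noteq> z" by force
  with closer_exists v z obtain x where "{v, x} \<in> E" "d x z < d v z" by blast
  with e show "e \<in> (\<Union>x\<in>nbrs E v. edge_arc V E v x r)" by (auto simp: nbrs_def edge_arc_iff)
next
  fix e assume "e \<in> (\<Union>x\<in>nbrs E v. edge_arc V E v x r)"
  then obtain x where "{v, x} \<in> E" "e \<in> edge_arc V E v x r" by (auto simp: nbrs_def)
  with edge_arc_subset_sphere[of v x r] show "e \<in> edge_sphere V E v r" by blast
qed

lemma edge_arcs_disjoint:
  assumes "x \<in> nbrs E v" "x' \<in> nbrs E v" "x \<noteq> x'"
  shows "edge_arc V E v x r \<inter> edge_arc V E v x' r = {}"
proof (rule ccontr)
  have vx: "{v, x} \<in> E" "{v, x'} \<in> E" using assms by (auto simp: nbrs_def)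
  assume "\<not> ?thesis"
  then obtain e where e: "e \<in> edge_arc V E v x r" "e \<in> edge_arc V E v x' r" by blast
  with edge_arc_subset_sphere[OF vx(1)] have "e \<in> edge_sphere V E v r" by blast
  moreover have "v \<in> V" using edge_verts[OF vx(1)] by blast
  ultimately obtain y z where "e = {y, z}" "{y, z} \<in> E" "d y v = r" "d z v = Suc r"
    by (rule edge_sphereE)
  with e vx have "d x z < d v z" "d x' z < d v z" "z \<in> V"
    using edge_verts by (simp_all add: edge_arc_iff)
  with closer_unique[OF vx] assms(3) show False by simp
qed

text \<open>The sphere of \<open>w\<close> splits into the arcs of its neighbours. Edges in the arc of \<open>w \<rightarrow> w'\<close> are not
  further from \<open>w'\<close> than from \<open>w\<close>; from the edges in all other arcs, \<open>w'\<close> is one step further than \<open>w\<close>.\<close>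

lemma edge_arc_Suc_eq_UN:
  assumes ww: "{w', w} \<in> E"
  shows "edge_arc V E w' w (Suc r) = (\<Union>x\<in>nbrs E w - {w'}. edge_arc V E w x r)"
proof (intro equalityI subsetI)
  have w: "w' \<in> V" "w \<in> V" using edge_verts ww by blast+
  {
    fix e assume e: "e \<in> edge_arc V E w' w (Suc r)"
    then obtain x where x: "x \<in> nbrs E w" "e \<in> edge_arc V E w x r"
      using edge_sphere_eq_UN_arcs[OF w(2), of r] by auto
    moreover have "x \<noteq> w'"
    proof
      assume "x = w'"
      with x have arc: "e \<in> edge_arc V E w w' r" by simp
      have "d w' w' = 0" using w dist_eq_0 by simp
      then have "{w, w'} \<in> edge_sphere V E w' 0"
        using ww by (simp add: edge_sphere_iff insert_commute)
      with arc have "e \<in> edge_sphere V E w' (r - 1)" by (cases r) auto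
      moreover have "e \<in> edge_sphere V E w' (Suc r)" using e by simp
      ultimately show False using edge_sphere_radius by fastforce
    qed
    ultimately show "e \<in> (\<Union>x\<in>nbrs E w - {w'}. edge_arc V E w x r)" by blast
  }
  fix e assume "e \<in> (\<Union>x\<in>nbrs E w - {w'}. edge_arc V E w x r)"
  then obtain x where x: "{w, x} \<in> E" "x \<noteq> w'" and e: "e \<in> edge_arc V E w x r"
    by (auto simp: nbrs_def)
  have sph: "e \<in> edge_sphere V E w r" using edge_arc_subset_sphere[OF x(1)] e by blast
  then obtain y z where yz: "e = {y, z}" "{y, z} \<in> E" "d y w = r" "d z w = Suc r"
    using w(2) by (rule edge_sphereE)
  then have V: "y \<in> V" "z \<in> V" using edge_verts by blast+
  have ww': "{w, w'} \<in> E" using ww by (simp add: insert_commute)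
  have "d x z < d w z" using e yz x by (simp add: edge_arc_iff)
  with closer_unique[OF x(1) ww' V(2)] x(2) have "\<not> d w' z < d w z" by blast
  with dist_step[OF ww' V(2)] have "d w' z = Suc (d w z)" by auto
  with yz have "d z w' = Suc (Suc r)" using dist_sym w V by metis
  moreover have "d y w' \<le> Suc r"
    using dist_step[OF ww' V(1)] yz(3) dist_sym[OF V(1) w(1)] dist_sym[OF V(1) w(2)] by auto
  ultimately have "min (d y w') (d z w') = Suc r"
    using dist_step[OF yz(2) w(1)] by auto
  with sph yz show "e \<in> edge_arc V E w' w (Suc r)" by (auto simp: edge_sphere_iff)
qed

end

section \<open>The universal cover is a tree\<close>

text \<open>The distance in the tree of all lists, with a list adjacent to its one-element extensions: the
  path between two lists goes through their longest common prefix. The cover is a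
  subtree of this tree, so its distance is the same.\<close>

fun tree_dist :: "'a list \<Rightarrow> 'a list \<Rightarrow> nat" where
  "tree_dist [] ys = length ys"
| "tree_dist (x # xs) [] = Suc (length xs)"
| "tree_dist (x # xs) (y # ys) =
     (if x = y then tree_dist xs ys else length xs + length ys + 2)"

lemma tree_dist_Nil2 [simp]: "tree_dist xs [] = length xs"
  by (cases xs) auto

lemma tree_dist_sym: "tree_dist xs ys = tree_dist ys xs"
  by (induction xs ys rule: tree_dist.induct) (auto simp: neq_Nil_conv)

lemma tree_dist_eq_0: "tree_dist xs ys = 0 \<longleftrightarrow> xs = ys"
  by (induction xs ys rule: tree_dist.induct) auto

lemma tree_dist_snoc_prefix: "prefix (xs @ [v]) ys \<Longrightarrow> tree_dist xs ys = Suc (tree_dist (xs @ [v]) ys)"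
proof (induction xs ys rule: tree_dist.induct)
  case (1 ys)
  then show ?case by (cases ys) auto
qed auto

lemma tree_dist_snoc_not_prefix: "\<not> prefix (xs @ [v]) ys \<Longrightarrow> tree_dist (xs @ [v]) ys = Suc (tree_dist xs ys)"
proof (induction xs ys rule: tree_dist.induct)
  case (1 ys)
  then show ?case by (cases ys) auto
qed auto

context
  fixes V :: "'a set" and E :: "'a set set" and s :: 'a
begin

abbreviation (input) "CV \<equiv> cover_verts V E s"
abbreviation (input) "CE \<equiv> cover_edges V E s"

lemma cover_edges_iff:
  "{xs, ys} \<in> CE \<longleftrightarrow> xs \<in> CV \<and> ys \<in> CV \<and> ((\<exists>v. ys = xs @ [v]) \<or> (\<exists>v. xs = ys @ [v]))"
  unfolding cover_edges_def by (auto simp: doubleton_eq_iff)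

lemma cover_verts_butlast:
  assumes "xs @ [v] \<in> CV" "xs \<noteq> []"
  shows "xs \<in> CV"
proof -
  have "xs ! i \<noteq> xs ! (i + 2)" if "i + 2 < length xs" for i
  proof -
    have "(xs @ [v]) ! i \<noteq> (xs @ [v]) ! (i + 2)" using assms(1) that by (simp add: cover_verts_def)
    with that show ?thesis by (simp add: nth_append)
  qed
  with assms show ?thesis by (auto simp: cover_verts_def walk_def successively_append_iff)
qed

lemma cover_verts_prefix: "ys \<in> CV \<Longrightarrow> prefix xs ys \<Longrightarrow> xs \<noteq> [] \<Longrightarrow> xs \<in> CV"
proof (induction ys rule: rev_induct)
  case (snoc v ys)
  then show ?case using cover_verts_butlast[of ys v] by (cases "ys = []") (auto simp: prefix_Cons)
qed (simp add: cover_verts_def walk_def)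

lemma tree_dist_step:
  "{xs, ys} \<in> CE \<Longrightarrow> tree_dist xs c = Suc (tree_dist ys c) \<or> tree_dist ys c = Suc (tree_dist xs c)"
  unfolding cover_edges_iff using tree_dist_snoc_prefix tree_dist_snoc_not_prefix by metis

text \<open>The step towards \<open>c\<close> appends the next entry of \<open>c\<close> if \<open>xs\<close> is a prefix of \<open>c\<close>, and drops the last
  entry otherwise. The root is never dropped, because it is a prefix of every \<open>c\<close>.\<close>

lemma tree_dist_descend:
  assumes "xs \<in> CV" "c \<in> CV" "xs \<noteq> c"
  shows "\<exists>ys. {xs, ys} \<in> CE \<and> tree_dist xs c = Suc (tree_dist ys c)"
proof (cases "prefix xs c")
  case True
  with assms(3) obtain v zs where c: "c = xs @ v # zs"
    by (metis prefix_def append_Nil2 neq_Nil_conv)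
  then have "prefix (xs @ [v]) c" by simp
  moreover from this have "xs @ [v] \<in> CV" using cover_verts_prefix[OF assms(2)] by blast
  ultimately show ?thesis
    using assms(1) tree_dist_snoc_prefix by (intro exI[of _ "xs @ [v]"]) (auto simp: cover_edges_iff)
next
  case False
  from assms have ne: "xs \<noteq> []" "c \<noteq> []" "hd xs = s" "hd c = s"
    by (auto simp: cover_verts_def walk_def)
  then obtain ys v where xs: "xs = ys @ [v]" by (metis rev_exhaust)
  have "ys \<noteq> []"
  proof
    assume "ys = []"
    with xs ne have "xs = [s]" by simp
    with False ne show False by (cases c) auto
  qed
  then have "ys \<in> CV" using cover_verts_butlast assms(1) xs by blast
  with False xs assms(1) show ?thesis
    using tree_dist_snoc_not_prefix by (intro exI[of _ ys]) (auto simp: cover_edges_iff)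
qed

lemma tree_dist_descend_unique:
  assumes "{xs, ys} \<in> CE" "{xs, zs} \<in> CE" "tree_dist ys c < tree_dist xs c" "tree_dist zs c < tree_dist xs c"
  shows "ys = zs"
proof -
  have *: "(\<exists>v. ys = xs @ [v] \<and> prefix ys c) \<or> (\<exists>v. xs = ys @ [v] \<and> \<not> prefix xs c)"
    if "{xs, ys} \<in> CE" "tree_dist ys c < tree_dist xs c" for ys
    using that tree_dist_snoc_prefix[of _ _ c] tree_dist_snoc_not_prefix[of _ _ c]
    unfolding cover_edges_iff by (metis lessI less_asym)
  from *[OF assms(1,3)] *[OF assms(2,4)] show ?thesis
    by (auto simp: prefix_def)
qed

lemma cover_dist:
  assumes "xs \<in> CV" "c \<in> CV"
  shows "graph_dist CV CE xs c = tree_dist xs c"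
proof (rule graph_dist_eqI)
  show "tree_dist c c = 0" by (simp add: tree_dist_eq_0)
  show "tree_dist x c \<le> Suc (tree_dist y c)" if "{x, y} \<in> CE" for x y
    using tree_dist_step[OF that, of c] by auto
  show "\<exists>y\<in>CV. {x, y} \<in> CE \<and> tree_dist x c = Suc (tree_dist y c)" if "x \<in> CV" "x \<noteq> c" for x
    using tree_dist_descend[OF that(1) assms(2) that(2)] cover_edges_iff by blast
qed (use assms in auto)

lemma cover_distance_tree: "distance_tree CV CE"
proof
  show verts: "x \<in> CV \<and> y \<in> CV" if "{x, y} \<in> CE" for x y
    using that by (simp add: cover_edges_iff)
  show "graph_dist CV CE x y = 0 \<longleftrightarrow> x = y" if "x \<in> CV" "y \<in> CV" for x y
    using that by (simp add: cover_dist tree_dist_eq_0)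
  show "graph_dist CV CE x y = graph_dist CV CE y x" if "x \<in> CV" "y \<in> CV" for x y
    using that by (simp add: cover_dist tree_dist_sym)
  show "graph_dist CV CE x c = Suc (graph_dist CV CE y c) \<or> graph_dist CV CE y c = Suc (graph_dist CV CE x c)"
    if "{x, y} \<in> CE" "c \<in> CV" for x y c
    using verts[OF that(1)] tree_dist_step[OF that(1), of c] that(2) by (simp add: cover_dist)
  show "\<exists>y. {x, y} \<in> CE \<and> graph_dist CV CE y c < graph_dist CV CE x c"
    if "x \<in> CV" "c \<in> CV" "x \<noteq> c" for x c
    using tree_dist_descend[OF that] verts that by (metis cover_dist lessI)
  show "y = z" if "{x, y} \<in> CE" "{x, z} \<in> CE" "c \<in> CV"
    "graph_dist CV CE y c < graph_dist CV CE x c" "graph_dist CV CE z c < graph_dist CV CE x c" for x y z c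
    using tree_dist_descend_unique[OF that(1,2), of c] that verts by (simp add: cover_dist)
qed

lemma cover_nbr_edge:
  assumes "{w, x} \<in> CE"
  shows "{last w, last x} \<in> E"
proof -
  have *: "{last u, v} \<in> E" if "u @ [v] \<in> CV" "u \<noteq> []" for u v
    using that by (auto simp: cover_verts_def walk_def successively_append_iff)
  from assms have "w \<in> CV" "x \<in> CV" by (simp_all add: cover_edges_iff)
  then have "w \<noteq> []" "x \<noteq> []" by (auto simp: cover_verts_def walk_def)
  moreover have "(\<exists>v. x = w @ [v]) \<or> (\<exists>v. w = x @ [v])" using assms by (simp add: cover_edges_iff)
  ultimately show ?thesis using \<open>w \<in> CV\<close> \<open>x \<in> CV\<close> *
    by (elim disjE exE) (simp_all add: insert_commute)
qed

text \<open>Two extensions of \<open>w\<close> differ in their last entries; an extension and the shortened list differ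
  there because paths do not backtrack.\<close>

lemma cover_nbr_last_inj:
  assumes "{w, x} \<in> CE" "{w, y} \<in> CE" "last x = last y"
  shows "x = y"
proof -
  have *: False if "u @ [v, u'] \<in> CV" "last u = u'" "u \<noteq> []" for u v u'
  proof -
    from that obtain u0 where u: "u @ [v, u'] = u0 @ [u', v, u']"
      by (metis append.assoc append_Cons append_Nil append_butlast_last_id)
    have "\<forall>i. i + 2 < length (u0 @ [u', v, u']) \<longrightarrow> (u0 @ [u', v, u']) ! i \<noteq> (u0 @ [u', v, u']) ! (i + 2)"
      using that(1) unfolding u cover_verts_def by blast
    from spec[OF this, of "length u0"] show False by (simp add: nth_append)
  qed
  have ne: "x \<noteq> []" "y \<noteq> []"
    using assms by (auto simp: cover_edges_iff cover_verts_def walk_def)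
  have CV: "x \<in> CV" "y \<in> CV" using assms by (auto simp: cover_edges_iff)
  have "(\<exists>a. x = w @ [a]) \<or> (\<exists>b. w = x @ [b])" "(\<exists>a. y = w @ [a]) \<or> (\<exists>b. w = y @ [b])"
    using assms(1,2) by (simp_all add: cover_edges_iff)
  then show ?thesis
  proof (elim disjE exE)
    fix a b assume eq: "x = w @ [a]" "y = w @ [b]"
    have "last x = a" "last y = b" unfolding eq by simp_all
    with assms(3) eq show ?thesis by metis
  next
    fix a b assume eq: "x = w @ [a]" "w = y @ [b]"
    have "last x = a" "x = y @ [b, a]" unfolding eq by simp_all
    with *[of y b a] CV(1) ne(2) assms(3) show ?thesis by metis
  next
    fix a b assume eq: "y = w @ [a]" "w = x @ [b]"
    have "last y = a" "y = x @ [b, a]" unfolding eq by simp_all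
    with *[of x b a] CV(2) ne(1) assms(3) show ?thesis by metis
  next
    fix a b assume "w = x @ [a]" "w = y @ [b]"
    then show ?thesis by (metis butlast_snoc)
  qed
qed

end

section \<open>Arc means as zigzag averages\<close>

definition bipartition :: "'a set set \<Rightarrow> 'a set \<Rightarrow> 'a set \<Rightarrow> bool" where
  "bipartition E X Y \<longleftrightarrow> X \<inter> Y = {} \<and> (\<forall>e\<in>E. \<exists>x\<in>X. \<exists>y\<in>Y. e = {x, y})"

lemma bipartition_swap: "bipartition E X Y \<Longrightarrow> bipartition E Y X"
  unfolding bipartition_def by (metis Int_commute insert_commute)

lemma bipartition_cases: "bipartition E X Y \<Longrightarrow> e \<in> E \<Longrightarrow> v \<in> e \<Longrightarrow> v \<in> X \<or> v \<in> Y"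
  unfolding bipartition_def by fastforce

lemma bipartition_Int: "bipartition E X Y \<Longrightarrow> e \<in> E \<Longrightarrow> v \<in> X \<Longrightarrow> e \<inter> X = {v} \<longleftrightarrow> v \<in> e"
  unfolding bipartition_def by fastforce

lemma opposite_endpoint:
  assumes "bipartition E X Y" "{u, v} \<in> E" "u \<in> X"
    and "{deg u, deg v} = {k + 1, l + 1 :: nat}" "deg u = k + 1"
  shows "v \<in> Y" "deg v = l + 1"
  using assms unfolding bipartition_def by (force simp: doubleton_eq_iff)+

lemma part_of_star:
  assumes "bipartition E X Y" "e \<in> E" "v \<in> e" "v \<in> X"
  shows "part_of E (\<lambda>e. e \<inter> X) e = {e' \<in> E. v \<in> e'}"
  using bipartition_Int[OF assms(1) _ assms(4)] assms(2,3) by (auto simp: part_of_def)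

lemma thick_stars:
  assumes "bipartition E X Y" "finite E" "\<And>e v. e \<in> E \<Longrightarrow> v \<in> e \<Longrightarrow> 3 \<le> vertex_degree E v"
  shows "thick_parts E (\<lambda>e. e \<inter> X)"
  unfolding thick_parts_def
proof (intro conjI ballI)
  fix e assume e: "e \<in> E"
  with assms(1) obtain v where v: "v \<in> X" "v \<in> e" unfolding bipartition_def by fastforce
  with part_of_star[OF assms(1) e v(2,1)] assms(3)[OF e v(2)]
  show "3 \<le> card (part_of E (\<lambda>e. e \<inter> X) e)" by (simp add: vertex_degree_def)
qed (fact assms(2))

text \<open>Edges with a common endpoint have the same label on the side of that endpoint, so walks in
  the graph become chains of the relation on edges.\<close>

lemma edges_at_vertex_linked:
  assumes "bipartition E X Y" "e \<in> E" "e' \<in> E" "v \<in> e" "v \<in> e'"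
  shows "(e, e') \<in> same_part_rel E (\<lambda>e. e \<inter> X) (\<lambda>e. e \<inter> Y)"
proof -
  have "v \<in> X \<or> v \<in> Y" using bipartition_cases[OF assms(1,2,4)] .
  then have "e \<inter> X = e' \<inter> X \<or> e \<inter> Y = e' \<inter> Y"
    using bipartition_Int[OF assms(1)] bipartition_Int[OF bipartition_swap[OF assms(1)]] assms(2-5)
    by metis
  with assms(2,3) show ?thesis by (simp add: same_part_rel_def)
qed

lemma walk_links_edges:
  assumes bip: "bipartition E X Y" and "e \<in> E" "hd xs \<in> e"
    and "successively (\<lambda>u v. {u, v} \<in> E) xs" "xs \<noteq> []"
  shows "\<exists>e'\<in>E. last xs \<in> e' \<and> (e, e') \<in> (same_part_rel E (\<lambda>e. e \<inter> X) (\<lambda>e. e \<inter> Y))\<^sup>*"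
  using assms(4,5,3)
proof (induction xs rule: rev_induct)
  case (snoc v xs)
  show ?case
  proof (cases "xs = []")
    case True
    with snoc.prems assms(2) show ?thesis by auto
  next
    case False
    with snoc.prems have "successively (\<lambda>u v. {u, v} \<in> E) xs" "hd xs \<in> e" and new: "{last xs, v} \<in> E"
      by (auto simp: successively_append_iff)
    with snoc.IH False obtain e' where e': "e' \<in> E" "last xs \<in> e'"
        "(e, e') \<in> (same_part_rel E (\<lambda>e. e \<inter> X) (\<lambda>e. e \<inter> Y))\<^sup>*" by blast
    from edges_at_vertex_linked[OF bip e'(1) new e'(2)] e'(3)
    have "(e, {last xs, v}) \<in> (same_part_rel E (\<lambda>e. e \<inter> X) (\<lambda>e. e \<inter> Y))\<^sup>*"
      by (simp add: rtrancl.rtrancl_into_rtrancl)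
    with new show ?thesis by (intro bexI[of _ "{last xs, v}"]) auto
  qed
qed simp

lemma connected_edges_linked:
  assumes "simple_graph V E" "connected_graph V E" and bip: "bipartition E X Y"
  shows "E \<times> E \<subseteq> (same_part_rel E (\<lambda>e. e \<inter> X) (\<lambda>e. e \<inter> Y))\<^sup>*"
proof clarify
  fix e e' assume e: "e \<in> E" "e' \<in> E"
  with assms(1) obtain u v where uv: "u \<in> e" "v \<in> e'" "u \<in> V" "v \<in> V"
    unfolding simple_graph_def by (metis insertI1)
  with assms(2) obtain xs where "walk V E xs" "hd xs = u" "last xs = v"
    unfolding connected_graph_def by blast
  with walk_links_edges[OF bip e(1), of xs] uv obtain e'' where "e'' \<in> E" "v \<in> e''"
      "(e, e'') \<in> (same_part_rel E (\<lambda>e. e \<inter> X) (\<lambda>e. e \<inter> Y))\<^sup>*"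
    by (auto simp: walk_def)
  with edges_at_vertex_linked[OF bip _ e(2) _ uv(2)]
  show "(e, e') \<in> (same_part_rel E (\<lambda>e. e \<inter> X) (\<lambda>e. e \<inter> Y))\<^sup>*"
    by (meson rtrancl.rtrancl_into_rtrancl)
qed

text \<open>The projection is a local isomorphism: surjectivity on stars is the lifting of edges, and
  injectivity is the absence of backtracking.\<close>

lemma cover_star:
  assumes simple: "simple_graph V E" and w: "w \<in> cover_verts V E s"
  shows "bij_betw (\<lambda>x. last ` {w, x}) (nbrs (cover_edges V E s) w) {e \<in> E. last w \<in> e}"
proof (rule bij_betw_imageI)
  show "inj_on (\<lambda>x. last ` {w, x}) (nbrs (cover_edges V E s) w)"
    by (rule inj_onI) (auto simp: nbrs_def doubleton_eq_iff intro: cover_nbr_last_inj)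
  show "(\<lambda>x. last ` {w, x}) ` nbrs (cover_edges V E s) w = {e \<in> E. last w \<in> e}"
  proof (intro equalityI subsetI)
    fix e assume "e \<in> (\<lambda>x. last ` {w, x}) ` nbrs (cover_edges V E s) w"
    then show "e \<in> {e \<in> E. last w \<in> e}" by (auto simp: nbrs_def dest: cover_nbr_edge)
  next
    fix e assume e: "e \<in> {e \<in> E. last w \<in> e}"
    with simple obtain v where v: "e = {last w, v}" "v \<in> V"
      unfolding simple_graph_def by (force simp: insert_commute)
    with cover_step[OF w, of v] e obtain x where "last x = v" "{w, x} \<in> cover_edges V E s" by blast
    with v show "e \<in> (\<lambda>x. last ` {w, x}) ` nbrs (cover_edges V E s) w"
      by (auto simp: nbrs_def)
  qed
qed

text \<open>The degrees alternate along the cover, so \<open>k\<close> and \<open>l\<close> are exchanged at each step.\<close>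

fun arc_size :: "nat \<Rightarrow> nat \<Rightarrow> nat \<Rightarrow> nat" where
  "arc_size k l 0 = 1"
| "arc_size k l (Suc r) = k * arc_size l k r"

text \<open>The arc splits into the arcs of the continuations of \<open>w' \<rightarrow> w\<close>. Their common cardinality turns
  the mean over the arc into the mean of their means, and their projections are the edges at
  the head \<open>last w\<close> other than the projection of \<open>w' \<rightarrow> w\<close>, over which \<open>turn\<close> averages.
  Equality of the cardinalities is part of the induction, as it depends on the degree
  of the head alone.\<close>

lemma edge_arc_zigzag:
  assumes simple: "simple_graph V E" and fin: "finite E"
    and "bipartition E X Y"
    and "\<And>u v. {u, v} \<in> E \<Longrightarrow> {vertex_degree E u, vertex_degree E v} = {k + 1, l + 1}"
    and "{w', w} \<in> cover_edges V E s" "last w \<in> X" "vertex_degree E (last w) = k + 1"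
  shows "finite (edge_arc (cover_verts V E s) (cover_edges V E s) w' w r)
    \<and> card (edge_arc (cover_verts V E s) (cover_edges V E s) w' w r) = arc_size k l r
    \<and> average (lift_fun f) (edge_arc (cover_verts V E s) (cover_edges V E s) w' w r)
        = zigzag E (\<lambda>e. e \<inter> X) (\<lambda>e. e \<inter> Y) r f (last ` {w', w})"
  using assms(3-)
proof (induction r arbitrary: X Y k l w' w)
  case 0
  then show ?case by (simp add: average_def lift_fun_def)
next
  case (Suc r)
  let ?CV = "cover_verts V E s" and ?CE = "cover_edges V E s"
  let ?arc = "\<lambda>x. edge_arc ?CV ?CE w x r" and ?e = "\<lambda>x. last ` {w, x}"
  interpret distance_tree ?CV ?CE by (rule cover_distance_tree)
  define I where "I = nbrs ?CE w - {w'}"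
  have w: "w \<in> ?CV" using edge_verts[OF Suc.prems(3)] by blast
  have w': "w' \<in> nbrs ?CE w" using Suc.prems(3) by (simp add: nbrs_def insert_commute)
  note star = cover_star[OF simple w]
  have finS: "finite {e \<in> E. last w \<in> e}" using fin by simp
  have finN: "finite (nbrs ?CE w)" using bij_betw_finite[OF star] finS by blast
  have "card (nbrs ?CE w) = k + 1"
    using bij_betw_same_card[OF star] Suc.prems(5) by (simp add: vertex_degree_def)
  then have cardI: "card I = k" using w' finN by (simp add: I_def)
  have finI: "finite I" using finN by (simp add: I_def)
  have IH: "finite (?arc x) \<and> card (?arc x) = arc_size l k r \<and>
      average (lift_fun f) (?arc x) = zigzag E (\<lambda>e. e \<inter> Y) (\<lambda>e. e \<inter> X) r f (?e x)"
    if "x \<in> I" for x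
  proof -
    have wx: "{w, x} \<in> ?CE" using that by (simp add: I_def nbrs_def)
    then have e: "{last w, last x} \<in> E" by (rule cover_nbr_edge)
    note opposite_endpoint[OF Suc.prems(1) e Suc.prems(4) Suc.prems(2)[OF e] Suc.prems(5)]
    moreover have "{vertex_degree E u, vertex_degree E v} = {l + 1, k + 1}" if "{u, v} \<in> E" for u v
      using Suc.prems(2)[OF that] by (simp add: insert_commute)
    ultimately show ?thesis
      using bipartition_swap[OF Suc.prems(1)] wx by (intro Suc.IH) auto
  qed
  have arc: "edge_arc ?CV ?CE w' w (Suc r) = (\<Union>x\<in>I. ?arc x)"
    using edge_arc_Suc_eq_UN[OF Suc.prems(3)] by (simp only: I_def)
  have disj: "?arc x \<inter> ?arc x' = {}" if "x \<in> I" "x' \<in> I" "x \<noteq> x'" for x x'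
    using edge_arcs_disjoint that by (simp add: I_def)
  have inj: "inj_on ?e I" using star by (auto simp: I_def bij_betw_def intro: inj_on_subset)
  have e0: "last ` {w', w} \<in> E" "last w \<in> last ` {w', w}"
    using cover_nbr_edge[OF Suc.prems(3)] by auto
  have "?e ` I = ?e ` nbrs ?CE w - {?e w'}"
    unfolding I_def using star w' by (subst inj_on_image_set_diff) (auto simp: bij_betw_def)
  also have "?e ` nbrs ?CE w = part_of E (\<lambda>e. e \<inter> X) (last ` {w', w})"
    using part_of_star[OF Suc.prems(1) e0 Suc.prems(4)] star by (simp add: bij_betw_def)
  also have "?e w' = last ` {w', w}" by auto
  finally have img: "?e ` I = part_of E (\<lambda>e. e \<inter> X) (last ` {w', w}) - {last ` {w', w}}" .
  have "average (lift_fun f) (edge_arc ?CV ?CE w' w (Suc r))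
      = average (\<lambda>x. average (lift_fun f) (?arc x)) I"
    unfolding arc using finI IH disj by (intro average_UN_equal_card) auto
  also have "\<dots> = average (\<lambda>x. zigzag E (\<lambda>e. e \<inter> Y) (\<lambda>e. e \<inter> X) r f (?e x)) I"
    using IH by (intro average_cong) auto
  also have "\<dots> = average (zigzag E (\<lambda>e. e \<inter> Y) (\<lambda>e. e \<inter> X) r f) (?e ` I)"
    using average_image[OF inj] by simp
  also have "\<dots> = zigzag E (\<lambda>e. e \<inter> X) (\<lambda>e. e \<inter> Y) (Suc r) f (last ` {w', w})"
    by (simp only: img zigzag.simps turn_def)
  finally have "average (lift_fun f) (edge_arc ?CV ?CE w' w (Suc r))
      = zigzag E (\<lambda>e. e \<inter> X) (\<lambda>e. e \<inter> Y) (Suc r) f (last ` {w', w})" .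
  moreover have "card (\<Union>x\<in>I. ?arc x) = card I * arc_size l k r"
    using finI IH disj by (subst card_UN_disjoint) auto
  moreover have "finite (\<Union>x\<in>I. ?arc x)" using finI IH by auto
  ultimately show ?case by (simp add: arc cardI del: edge_arc.simps)
qed

lemma sphere_mean_eq_average_arc_means:
  assumes simple: "simple_graph V E" and fin: "finite E" and bip: "bipartition E X Y"
    and degs: "\<And>u v. {u, v} \<in> E \<Longrightarrow> {vertex_degree E u, vertex_degree E v} = {k + 1, l + 1}"
    and v: "v \<in> cover_verts V E s" "last v \<in> X" "vertex_degree E (last v) = k + 1"
  shows "sphere_mean V E s f v r = average (\<lambda>x. arc_mean V E s f v x r) (nbrs (cover_edges V E s) v)"
proof -
  let ?CV = "cover_verts V E s" and ?CE = "cover_edges V E s"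
  let ?arc = "\<lambda>x. edge_arc ?CV ?CE v x r"
  interpret distance_tree ?CV ?CE by (rule cover_distance_tree)
  have finN: "finite (nbrs ?CE v)" using bij_betw_finite[OF cover_star[OF simple v(1)]] fin by simp
  have arc: "finite (?arc x) \<and> card (?arc x) = arc_size l k r" if "x \<in> nbrs ?CE v" for x
  proof -
    have vx: "{v, x} \<in> ?CE" using that by (simp add: nbrs_def)
    then have e: "{last v, last x} \<in> E" by (rule cover_nbr_edge)
    note opposite_endpoint[OF bip e v(2) degs[OF e] v(3)]
    moreover have "{vertex_degree E u, vertex_degree E v} = {l + 1, k + 1}" if "{u, v} \<in> E" for u v
      using degs[OF that] by (simp add: insert_commute)
    ultimately show ?thesis
      using edge_arc_zigzag[OF simple fin bipartition_swap[OF bip] _ vx] by blast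
  qed
  have "average (lift_fun f) (\<Union>x\<in>nbrs ?CE v. ?arc x)
      = average (\<lambda>x. average (lift_fun f) (?arc x)) (nbrs ?CE v)"
    using finN arc edge_arcs_disjoint by (intro average_UN_equal_card) auto
  then show ?thesis
    by (simp add: sphere_mean_def arc_mean_def edge_sphere_eq_UN_arcs[OF v(1)])
qed

lemma vertex_on_edge:
  assumes "connected_graph V E" "simple_graph V E" "E \<noteq> {}" "v \<in> V"
  shows "{e \<in> E. v \<in> e} \<noteq> {}"
proof -
  from assms(2,3) obtain e u where e: "e \<in> E" "u \<in> e" "u \<in> V"
    unfolding simple_graph_def by (metis all_not_in_conv insertI1)
  with assms(1,4) obtain xs where xs: "walk V E xs" "hd xs = v" "last xs = u"
    unfolding connected_graph_def by blast
  show ?thesis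
  proof (cases "tl xs = []")
    case True
    with xs have "u = v" by (cases xs) (auto simp: walk_def)
    with e show ?thesis by blast
  next
    case False
    with xs obtain y ys where "xs = v # y # ys" by (metis list.collapse tl_Nil)
    with xs have "{v, y} \<in> E" by (simp add: walk_def)
    then show ?thesis by blast
  qed
qed

theorem corollary3:
  fixes V :: "'a set" and E :: "'a set set" and p q :: nat
  assumes "p \<ge> 2" and "q \<ge> 2" and "semiregular_graph V E p q"
  shows "\<exists>C>0. \<forall>f :: 'a set \<Rightarrow> real.
    \<exists>\<beta> \<in> {(real p * real q) powr (- 1 / 2)} \<union> {(real p * real q) powr (- 1 / 4) ..< 1}.
    \<forall>s\<in>V.
      (\<forall>u v. {u, v} \<in> E \<longrightarrow> (\<forall>w' w. is_lift V E s u v w' w \<longrightarrow>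
        (\<forall>r::nat. \<bar>arc_mean V E s f w' w r - average f E\<bar> \<le> C * L2_set f E * \<beta> ^ r))) \<and>
      (\<forall>v\<^sub>0 \<in> cover_verts V E s. \<forall>r::nat.
        \<bar>sphere_mean V E s f v\<^sub>0 r - average f E\<bar> \<le> C * L2_set f E * \<beta> ^ r)"
proof -
  have simple: "simple_graph V E" and conn: "connected_graph V E"
    and degs: "\<forall>e\<in>E. \<exists>u v. e = {u, v} \<and> vertex_degree E u = p + 1 \<and> vertex_degree E v = q + 1"
    using assms(3) by (auto simp: semiregular_graph_def)
  from assms(3) obtain A B where bip: "bipartition E A B"
    unfolding semiregular_graph_def bipartite_graph_def bipartition_def by blast
  have fin: "finite E"
  proof (rule finite_subset)
    show "E \<subseteq> Pow V" using simple by (auto simp: simple_graph_def)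
    show "finite (Pow V)" using assms(3) by (simp add: semiregular_graph_def)
  qed
  have deg: "{vertex_degree E u, vertex_degree E v} = {p + 1, q + 1}" if "{u, v} \<in> E" for u v
    using degs that by (force simp: doubleton_eq_iff)
  \<comment> \<open>Which of \<open>p\<close>, \<open>q\<close> belongs to a side is not fixed in advance; \<open>k + 1\<close> is the degree at hand.\<close>
  have degrees_at: "\<exists>k l. vertex_degree E v = k + 1 \<and>
      (\<forall>x y. {x, y} \<in> E \<longrightarrow> {vertex_degree E x, vertex_degree E y} = {k + 1, l + 1})"
    if "{v, u} \<in> E" for u v
  proof -
    from deg[OF that] consider "vertex_degree E v = p + 1" | "vertex_degree E v = q + 1" by auto
    then show ?thesis
    proof cases
      case 1
      with deg show ?thesis by blast
    next
      case 2
      with deg show ?thesis by (intro exI[of _ q] exI[of _ p]) (simp add: insert_commute)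
    qed
  qed
  have deg3: "3 \<le> vertex_degree E v" if "e \<in> E" "v \<in> e" for e v
    using degs that assms(1,2) by fastforce
  let ?\<alpha> = "\<lambda>e. e \<inter> A" and ?\<beta> = "\<lambda>e. e \<inter> B"
  have thick: "thick_parts E ?\<alpha>" "thick_parts E ?\<beta>"
    using thick_stars[OF bip fin] thick_stars[OF bipartition_swap[OF bip] fin] deg3 by blast+
  obtain \<rho> where \<rho>: "\<rho> < 1" and mix: "\<And>b f e r. \<rho> \<le> b \<Longrightarrow> 0 < b \<Longrightarrow> b \<le> 1 \<Longrightarrow> e \<in> E \<Longrightarrow>
      \<bar>zigzag E ?\<alpha> ?\<beta> r f e - average f E\<bar> \<le> 1 / b * L2_set f E * b ^ r"
    using zigzag_mixing[OF thick connected_edges_linked[OF simple conn bip]] by auto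
  obtain \<sigma> where \<sigma>: "\<sigma> < 1" and mix': "\<And>b f e r. \<sigma> \<le> b \<Longrightarrow> 0 < b \<Longrightarrow> b \<le> 1 \<Longrightarrow> e \<in> E \<Longrightarrow>
      \<bar>zigzag E ?\<beta> ?\<alpha> r f e - average f E\<bar> \<le> 1 / b * L2_set f E * b ^ r"
    using zigzag_mixing[OF thick(2,1)
        connected_edges_linked[OF simple conn bipartition_swap[OF bip]]] by auto
  \<comment> \<open>The maximum serves arcs with head in \<open>A\<close> and in \<open>B\<close> and meets the required lower bound.\<close>
  define b where "b = max (max \<rho> \<sigma>) ((real p * real q) powr (- 1 / 4))"
  have "1 < real p * real q"
    using mult_mono[of 2 "real p" 2 "real q"] assms(1,2) by simp
  then have "0 < (real p * real q) powr (- 1 / 4)" "(real p * real q) powr (- 1 / 4) < 1"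
    using assms(1,2) by (auto intro: powr_less_one)
  then have b: "\<rho> \<le> b" "\<sigma> \<le> b" "0 < b" "b < 1" "(real p * real q) powr (- 1 / 4) \<le> b"
    using \<rho> \<sigma> by (auto simp: b_def less_max_iff_disj)
  have arc: "\<bar>arc_mean V E s f w' w r - average f E\<bar> \<le> 1 / b * L2_set f E * b ^ r"
    if ww: "{w', w} \<in> cover_edges V E s" for s f w' w r
  proof -
    have "{last w', last w} \<in> E" using ww by (rule cover_nbr_edge)
    then have e: "last ` {w', w} \<in> E" by simp
    have "{last w, last w'} \<in> E" using \<open>{last w', last w} \<in> E\<close> by (simp add: insert_commute)
    from degrees_at[OF this]
    obtain k l where kl: "vertex_degree E (last w) = k + 1"
      and deg': "\<And>u v. {u, v} \<in> E \<Longrightarrow> {vertex_degree E u, vertex_degree E v} = {k + 1, l + 1}"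
      by blast
    have "last w \<in> A \<or> last w \<in> B" using bipartition_cases[OF bip e] by simp
    then show ?thesis
    proof
      assume "last w \<in> A"
      with edge_arc_zigzag[OF simple fin bip deg' ww this kl] mix[OF b(1,3) _ e] b(4)
      show ?thesis by (simp add: arc_mean_def)
    next
      assume "last w \<in> B"
      with edge_arc_zigzag[OF simple fin bipartition_swap[OF bip] deg' ww this kl] mix'[OF b(2,3) _ e] b(4)
      show ?thesis by (simp add: arc_mean_def)
    qed
  qed
  have sphere: "\<bar>sphere_mean V E s f v r - average f E\<bar> \<le> 1 / b * L2_set f E * b ^ r"
    if v: "v \<in> cover_verts V E s" for s f v r
  proof -
    let ?CV = "cover_verts V E s" and ?CE = "cover_edges V E s"
    interpret distance_tree ?CV ?CE by (rule cover_distance_tree)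
    note star = cover_star[OF simple v]
    have finN: "finite (nbrs ?CE v)" using bij_betw_finite[OF star] fin by simp
    show ?thesis
    proof (cases "E = {}")
      case True
      \<comment> \<open>A single vertex without edges: both means are \<open>0 / 0 = 0\<close>.\<close>
      then have "nbrs ?CE v = {}" using star by (simp add: bij_betw_def)
      then have "edge_sphere ?CV ?CE v r = {}" using edge_sphere_eq_UN_arcs[OF v] by simp
      with True show ?thesis by (simp add: sphere_mean_def average_def)
    next
      case False
      have "last v \<in> V" using v last_in_set by (force simp: cover_verts_def walk_def)
      from vertex_on_edge[OF conn simple False this] obtain u where u: "{last v, u} \<in> E"
        using bip unfolding bipartition_def by (fastforce simp: insert_commute)
      with star have ne: "nbrs ?CE v \<noteq> {}" by (auto simp: bij_betw_def)
      have "last v \<in> A \<or> last v \<in> B" using bipartition_cases[OF bip u] by simp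
      moreover from degrees_at[OF u]
      obtain k l where kl: "vertex_degree E (last v) = k + 1"
        and deg': "\<And>u v. {u, v} \<in> E \<Longrightarrow> {vertex_degree E u, vertex_degree E v} = {k + 1, l + 1}"
        by blast
      ultimately have "sphere_mean V E s f v r = average (\<lambda>x. arc_mean V E s f v x r) (nbrs ?CE v)"
        using sphere_mean_eq_average_arc_means[OF simple fin bip deg' v _ kl]
          sphere_mean_eq_average_arc_means[OF simple fin bipartition_swap[OF bip] deg' v _ kl]
        by blast
      with arc ne finN show ?thesis
        by (auto intro!: abs_average_diff_le simp: nbrs_def)
    qed
  qed
  show ?thesis
  proof (intro exI[of _ "1 / b"] conjI allI bexI[of _ b] ballI impI)
    show "0 < 1 / b" using b by simp
    show "b \<in> {(real p * real q) powr (- 1 / 2)} \<union> {(real p * real q) powr (- 1 / 4)..<1}"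
      using b by simp
  qed (use arc sphere in \<open>auto simp: is_lift_def\<close>)
qed

end
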